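(* Assume that $c$ is a real number and that the following conditions hold. (a) If $(u_n)\subset\mathcal{N}\cap Y$ and $\Phi(u_n)\to c$, then $(u_n)$ has a subsequence converging weakly in $X$ to an element of $Y$. (b) For every $u\in Y$ the map $\varphi_u$ belongs to $C^2(0,\infty)$ and has a non-degenerate (local) minimum point $t_u>0$ such that $\varphi_u'<0$ in $(0,t_u)$; moreover $\varphi_u(t_u)<\varphi_u(t)$ for any $t>0$, $t\neq t_u$, such that $\varphi_u'(t)=0$; in particular $\Phi(t_uu)=\varphi_u(t_u)<0$. (c) For every $u\in Y$: if $(u_n)\subset Y$, $u_n\rightharpoonup u$ in $X$ and $J(u_n)\to J(u)$, then $u_n\to u$ in $X$. Then $c<0$ and $c$ is achieved (by some element of $\mathcal{N}\cap Y$). In addition: (1) If $J$ is $C^1$ in $Y$, then $c$ is a local minimum of $\Phi$ (i.e. $c$ is the value of $\Phi$ at a local minimizer). (2) If $\Phi\geq 0$ on $\mathcal{N}\setminus Y$, then $c$ is the ground state level of $\Phi$.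
   Context: $X$ is a reflexive Banach space. $Y\subset X\setminus\{0\}$ is a nonempty open cone, i.e. a nonempty open set such that $tu\in Y$ for every $t>0$ and $u\in Y$. $\Phi\in C^1(X,\mathbb{R})$ with $\Phi(0)=0$, and $J:X\to\mathbb{R}$ is given by $J(u)=\Phi'(u)u$. Both $\Phi$ and $J$ are assumed weakly lower semicontinuous on $X$. $\mathcal{N}=\{u\in X\setminus\{0\}: \Phi'(u)u=0\}$ and $c:=\inf_{\mathcal{N}\cap Y}\Phi$. For $u\in X$, $\varphi_u(t)=\Phi(tu)$; a non-degenerate minimum point $t$ of $\varphi_u$ satisfies $\varphi_u'(t)=0<\varphi_u''(t)$. Strong and weak convergence are denoted by $\to$ and $\rightharpoonup$. A ground state is a nontrivial critical point of $\Phi$ minimizing $\Phi$ over the set of all nontrivial critical points; a number is the ground state level of $\Phi$ if it is the value of $\Phi$ at a ground state. *)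

theory Defs
  imports "HOL-Analysis.Analysis"
begin

text \<open>The canonical embedding into the bidual, with duals taken as spaces of bounded linear
  functionals.\<close>

lift_definition bidual_embed :: "'a::real_normed_vector \<Rightarrow> (('a \<Rightarrow>\<^sub>L real) \<Rightarrow>\<^sub>L real)"
  is "\<lambda>x f. blinfun_apply f x"
  by (rule blinfun.bounded_linear_left)

definition reflexive_space :: "'a::real_normed_vector itself \<Rightarrow> bool" where
  "reflexive_space _ \<longleftrightarrow> surj (bidual_embed :: 'a \<Rightarrow> _)"

definition weakly_converges :: "(nat \<Rightarrow> 'a::real_normed_vector) \<Rightarrow> 'a \<Rightarrow> bool" where
  "weakly_converges u x \<longleftrightarrow>
     (\<forall>f :: 'a \<Rightarrow>\<^sub>L real. (\<lambda>n. blinfun_apply f (u n)) \<longlonglongrightarrow> blinfun_apply f x)"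

text \<open>Weak lower semicontinuity is understood sequentially; lower semicontinuity with respect to
  the weak topology implies it.\<close>

definition weakly_lsc :: "('a::real_normed_vector \<Rightarrow> real) \<Rightarrow> bool" where
  "weakly_lsc f \<longleftrightarrow>
     (\<forall>u x. weakly_converges u x \<longrightarrow> ereal (f x) \<le> liminf (\<lambda>n. ereal (f (u n))))"

text \<open>Intended for open \<open>S\<close>; continuity of the derivative is with respect to the operator norm.\<close>

definition C1_on :: "'a::real_normed_vector set \<Rightarrow> ('a \<Rightarrow> real) \<Rightarrow> bool" where
  "C1_on S f \<longleftrightarrow>
     (\<exists>D :: 'a \<Rightarrow> ('a \<Rightarrow>\<^sub>L real).
        (\<forall>x\<in>S. (f has_derivative blinfun_apply (D x)) (at x)) \<and> continuous_on S D)"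

definition C2_real_on :: "real set \<Rightarrow> (real \<Rightarrow> real) \<Rightarrow> bool" where
  "C2_real_on S g \<longleftrightarrow>
     (\<forall>t\<in>S. g field_differentiable at t) \<and>
     (\<forall>t\<in>S. deriv g field_differentiable at t) \<and>
     continuous_on S (deriv (deriv g))"

definition local_minimizer :: "('a::topological_space \<Rightarrow> real) \<Rightarrow> 'a \<Rightarrow> bool" where
  "local_minimizer f x \<longleftrightarrow> (\<forall>\<^sub>F y in nhds x. f x \<le> f y)"

definition nondegenerate_min_point :: "(real \<Rightarrow> real) \<Rightarrow> real \<Rightarrow> bool" where
  "nondegenerate_min_point g t \<longleftrightarrow>
     local_minimizer g t \<and> deriv g t = 0 \<and> 0 < deriv (deriv g) t"

definition fibering :: "('a::real_normed_vector \<Rightarrow> real) \<Rightarrow> 'a \<Rightarrow> real \<Rightarrow> real" where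
  "fibering \<Phi> u t = \<Phi> (t *\<^sub>R u)"

text \<open>The functional \<open>J(u) = \<Phi>'(u)u\<close>.\<close>

definition nehari_functional :: "('a::real_normed_vector \<Rightarrow> real) \<Rightarrow> 'a \<Rightarrow> real" where
  "nehari_functional \<Phi> u = frechet_derivative \<Phi> (at u) u"

definition nehari_set :: "('a::real_normed_vector \<Rightarrow> real) \<Rightarrow> 'a set" where
  "nehari_set \<Phi> = {u. u \<noteq> 0 \<and> nehari_functional \<Phi> u = 0}"

definition nontrivial_critical_point :: "('a::real_normed_vector \<Rightarrow> real) \<Rightarrow> 'a \<Rightarrow> bool" where
  "nontrivial_critical_point \<Phi> u \<longleftrightarrow> u \<noteq> 0 \<and> (\<Phi> has_derivative (\<lambda>_. 0)) (at u)"

definition ground_state :: "('a::real_normed_vector \<Rightarrow> real) \<Rightarrow> 'a \<Rightarrow> bool" where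
  "ground_state \<Phi> u \<longleftrightarrow>
     nontrivial_critical_point \<Phi> u \<and> (\<forall>v. nontrivial_critical_point \<Phi> v \<longrightarrow> \<Phi> u \<le> \<Phi> v)"

definition ground_state_level :: "('a::real_normed_vector \<Rightarrow> real) \<Rightarrow> real \<Rightarrow> bool" where
  "ground_state_level \<Phi> c \<longleftrightarrow> (\<exists>u. ground_state \<Phi> u \<and> \<Phi> u = c)"

end

theory Submission
  imports Defs
begin

text \<open>
  Since \<open>J (t u) = t \<phi>\<^sub>u'(t)\<close>, the points of the Nehari set on the ray through \<open>u\<close> are the critical
  points of the fibering map \<open>\<phi>\<^sub>u\<close>, and the sign of \<open>J\<close> along the ray tells where \<open>\<phi>\<^sub>u\<close> increases.
  Condition (b) says that on each ray in \<open>Y\<close> the functional \<open>J\<close> is negative up to a point \<open>t\<^sub>u u\<close>,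
  vanishes there and is positive just beyond (\<open>ray_first_minimum\<close>), and that \<open>t\<^sub>u u\<close> has the least
  energy among the Nehari points of its ray.  As \<open>\<phi>\<^sub>u\<close> falls from \<open>\<phi>\<^sub>u(0) = 0\<close> to \<open>\<phi>\<^sub>u(t\<^sub>u)\<close>, this
  already gives \<open>c < 0\<close>.

  \<^emph>\<open>The infimum is attained.\<close>  Sliding each member of a minimizing sequence along its ray to the
  first minimum does not raise the energy, so there is a minimizing sequence \<open>w\<^sub>n\<close> with \<open>J (s w\<^sub>n) \<le> 0\<close> for
  all \<open>s \<in> (0,1]\<close>.  By weak lower semicontinuity of \<open>J\<close> a weak limit \<open>v \<in> Y\<close> inherits
  \<open>J (s v) \<le> 0\<close> on \<open>(0,1]\<close>; hence \<open>J\<close> has not yet become positive on the ray of \<open>v\<close>, that is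
  \<open>t\<^sub>v \<ge> 1\<close>.  So \<open>\<phi>\<^sub>v\<close> is nonincreasing on \<open>[1,t\<^sub>v]\<close>, and
  \<open>\<Phi> (t\<^sub>v v) \<le> \<Phi> v \<le> liminf \<Phi> (w\<^sub>n) = c\<close>.

  \<^emph>\<open>The minimizer is an unconstrained local minimizer.\<close>  Let \<open>w = t\<^sub>v v\<close>.  There are \<open>a < 1 < b\<close> with
  \<open>J (a w) < 0 < J (b w)\<close>, and \<open>J\<close> is continuous, so \<open>J (a y) < 0 < J (b y)\<close> for all \<open>y\<close> near \<open>w\<close>.
  The minimum of \<open>\<phi>\<^sub>y\<close> over \<open>[a,b]\<close> is then interior, so it is taken at a Nehari point of \<open>Y\<close>; hence
  \<open>\<Phi> y = \<phi>\<^sub>y(1) \<ge> c\<close> (\<open>local_minimizer_of_sign_change\<close>).  So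
  \<open>w\<close> is a critical point of \<open>\<Phi>\<close> without constraint, and every other nontrivial critical point,
  being a Nehari point, has energy at least \<open>c\<close> if it lies in \<open>Y\<close> and, under (2), energy at least \<open>0 > c\<close> if it does not.
\<close>

lemma C1_on_imp_has_frechet_derivative:
  fixes \<Phi> :: "'a::real_normed_vector \<Rightarrow> real"
  assumes "C1_on S \<Phi>" "x \<in> S"
  shows "(\<Phi> has_derivative frechet_derivative \<Phi> (at x)) (at x)"
  using assms unfolding C1_on_def by (metis differentiableI frechet_derivative_works)

lemma nehari_functional_eq_deriv_along_ray:
  assumes "C1_on UNIV \<Phi>"
  shows "(fibering \<Phi> u has_real_derivative deriv (fibering \<Phi> u) t) (at t)"
    and "nehari_functional \<Phi> (t *\<^sub>R u) = t * deriv (fibering \<Phi> u) t"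
proof -
  let ?D = "frechet_derivative \<Phi> (at (t *\<^sub>R u))"
  have D: "(\<Phi> has_derivative ?D) (at (t *\<^sub>R u))"
    using C1_on_imp_has_frechet_derivative[OF assms] by simp
  then have lin: "linear ?D"
    using has_derivative_linear by blast
  have "((\<lambda>s. \<Phi> (s *\<^sub>R u)) has_derivative (\<lambda>h. ?D (h *\<^sub>R u))) (at t)"
    by (rule has_derivative_compose[where f = "\<lambda>s. s *\<^sub>R u", OF _ D])
       (auto intro!: derivative_eq_intros)
  moreover have "(\<lambda>h. ?D (h *\<^sub>R u)) = (*) (?D u)"
    using lin by (auto simp: linear_scale)
  ultimately have d: "(fibering \<Phi> u has_real_derivative ?D u) (at t)"
    by (simp add: has_field_derivative_def fibering_def[abs_def])
  then show "(fibering \<Phi> u has_real_derivative deriv (fibering \<Phi> u) t) (at t)"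
    using DERIV_imp_deriv by fastforce
  show "nehari_functional \<Phi> (t *\<^sub>R u) = t * deriv (fibering \<Phi> u) t"
    using DERIV_imp_deriv[OF d] lin by (simp add: nehari_functional_def linear_scale)
qed

lemma continuous_on_nehari_functional:
  assumes "C1_on UNIV \<Phi>"
  shows "continuous_on UNIV (nehari_functional \<Phi>)"
proof -
  obtain D where D: "\<And>x. (\<Phi> has_derivative blinfun_apply (D x)) (at x)" "continuous_on UNIV D"
    using assms unfolding C1_on_def by auto
  have "nehari_functional \<Phi> = (\<lambda>x. blinfun_apply (D x) x)"
    using frechet_derivative_at[OF D(1)] by (auto simp: nehari_functional_def fun_eq_iff)
  then show ?thesis
    by (auto intro!: continuous_intros D(2))
qed

lemma weakly_converges_scaleR:
  assumes "weakly_converges u x"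
  shows "weakly_converges (\<lambda>n. s *\<^sub>R u n) (s *\<^sub>R x)"
  using assms unfolding weakly_converges_def
  by (auto simp: blinfun.scaleR_right intro: tendsto_mult_left)

text \<open>Condition (b) in terms of the sign of \<open>J\<close>.  Nondegeneracy makes \<open>J\<close> positive just
  beyond \<open>t u\<close>; this bounds \<open>t\<close> from below as soon as \<open>J \<le> 0\<close> is known on an initial segment of the
  ray.\<close>

lemma ray_first_minimum:
  assumes C1: "C1_on UNIV \<Phi>"
    and C2: "C2_real_on {0<..} (fibering \<Phi> u)"
    and t: "t > 0" "nondegenerate_min_point (fibering \<Phi> u) t"
    and neg: "\<And>s. s \<in> {0<..<t} \<Longrightarrow> deriv (fibering \<Phi> u) s < 0"
  shows "nehari_functional \<Phi> (t *\<^sub>R u) = 0"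
    and "\<And>s. s \<in> {0<..<t} \<Longrightarrow> nehari_functional \<Phi> (s *\<^sub>R u) < 0"
    and "\<exists>d>0. \<forall>s\<in>{t<..<t+d}. 0 < nehari_functional \<Phi> (s *\<^sub>R u)"
    and "\<Phi> (t *\<^sub>R u) < \<Phi> 0"
proof -
  note J = nehari_functional_eq_deriv_along_ray[OF C1, where u = u]
  have t': "deriv (fibering \<Phi> u) t = 0" "0 < deriv (deriv (fibering \<Phi> u)) t"
    using t unfolding nondegenerate_min_point_def by auto
  show "nehari_functional \<Phi> (t *\<^sub>R u) = 0"
    by (simp add: J t')
  show "nehari_functional \<Phi> (s *\<^sub>R u) < 0" if "s \<in> {0<..<t}" for s
    using neg[OF that] that by (simp add: J mult_pos_neg)
  have "(deriv (fibering \<Phi> u) has_real_derivative deriv (deriv (fibering \<Phi> u)) t) (at t)"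
    using C2 t(1) by (simp add: C2_real_on_def DERIV_deriv_iff_field_differentiable)
  from DERIV_pos_inc_right[OF this t'(2)] obtain d where "d > 0"
    and d: "\<And>h. h > 0 \<Longrightarrow> h < d \<Longrightarrow> 0 < deriv (fibering \<Phi> u) (t + h)"
    using t' by auto
  have "0 < nehari_functional \<Phi> (s *\<^sub>R u)" if "s \<in> {t<..<t+d}" for s
    using d[of "s - t"] that t(1) by (simp add: J)
  then show "\<exists>d>0. \<forall>s\<in>{t<..<t+d}. 0 < nehari_functional \<Phi> (s *\<^sub>R u)"
    using \<open>d > 0\<close> by blast
  have "fibering \<Phi> u t < fibering \<Phi> u 0"
  proof (rule DERIV_neg_imp_decreasing_open[OF t(1)])
    show "\<exists>y. (fibering \<Phi> u has_real_derivative y) (at s) \<and> y < 0" if "0 < s" "s < t" for s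
      using neg[of s] that J(1) by auto
    show "continuous_on {0..t} (fibering \<Phi> u)"
      using J(1) DERIV_isCont continuous_at_imp_continuous_on by blast
  qed
  then show "\<Phi> (t *\<^sub>R u) < \<Phi> 0"
    by (simp add: fibering_def)
qed

text \<open>The sign change of \<open>J\<close> is an open condition on the ray, and on every ray that has it the
  interval \<open>[a,b]\<close> contains a Nehari point with energy no larger than that at parameter \<open>1\<close>.\<close>

lemma local_minimizer_of_sign_change:
  fixes \<Phi> :: "'a::real_normed_vector \<Rightarrow> real"
  assumes C1: "C1_on UNIV \<Phi>"
    and Y: "open Y" "0 \<notin> Y" "\<And>t u. t > 0 \<Longrightarrow> u \<in> Y \<Longrightarrow> t *\<^sub>R u \<in> Y"
    and min: "\<And>v. v \<in> nehari_set \<Phi> \<inter> Y \<Longrightarrow> \<Phi> w \<le> \<Phi> v"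
    and w: "w \<in> Y"
    and ab: "0 < a" "a < 1" "1 < b"
    and sign: "nehari_functional \<Phi> (a *\<^sub>R w) < 0" "0 < nehari_functional \<Phi> (b *\<^sub>R w)"
  shows "local_minimizer \<Phi> w"
proof -
  let ?J = "nehari_functional \<Phi>"
  note J = nehari_functional_eq_deriv_along_ray[OF C1]
  have "isCont (\<lambda>y. ?J (s *\<^sub>R y)) w" for s
    by (rule isCont_o2[where g = ?J])
       (use continuous_on_nehari_functional[OF C1] in \<open>auto simp: continuous_on_eq_continuous_at\<close>)
  then have "((\<lambda>y. ?J (s *\<^sub>R y)) \<longlongrightarrow> ?J (s *\<^sub>R w)) (nhds w)" for s
    using tendsto_at_iff_tendsto_nhds[of "\<lambda>y. ?J (s *\<^sub>R y)" w] unfolding isCont_def by blast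
  then have "\<forall>\<^sub>F y in nhds w. ?J (a *\<^sub>R y) < 0" "\<forall>\<^sub>F y in nhds w. 0 < ?J (b *\<^sub>R y)"
    using sign order_tendstoD by blast+
  moreover have "\<forall>\<^sub>F y in nhds w. y \<in> Y"
    using Y(1) w by (rule eventually_nhds_in_open)
  ultimately have "\<forall>\<^sub>F y in nhds w. \<Phi> w \<le> \<Phi> y"
  proof eventually_elim
    case (elim y)
    let ?g = "fibering \<Phi> y"
    have "continuous_on {a..b} ?g"
      using J(1) DERIV_isCont continuous_at_imp_continuous_on by blast
    with continuous_attains_inf[of "{a..b}" ?g] ab obtain t
      where t: "a \<le> t" "t \<le> b" and t_min: "\<And>s. a \<le> s \<Longrightarrow> s \<le> b \<Longrightarrow> ?g t \<le> ?g s"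
      by auto
    have "t \<noteq> a"
    proof
      assume "t = a"
      have "deriv ?g a < 0"
        using elim(1) ab by (simp add: J(2) mult_less_0_iff)
      from DERIV_neg_dec_right[OF J(1) this] obtain d where "d > 0"
        and d: "\<And>h. h > 0 \<Longrightarrow> h < d \<Longrightarrow> ?g (a + h) < ?g a" by auto
      obtain h where "0 < h" "h < min d (b - a)"
        using dense[of 0 "min d (b - a)"] \<open>d > 0\<close> ab by auto
      then show False
        using d[of h] t_min[of "a + h"] \<open>t = a\<close> by auto
    qed
    moreover have "t \<noteq> b"
    proof
      assume "t = b"
      have "0 < deriv ?g b"
        using elim(2) ab by (simp add: J(2) zero_less_mult_iff)
      from DERIV_pos_inc_left[OF J(1) this] obtain d where "d > 0"
        and d: "\<And>h. h > 0 \<Longrightarrow> h < d \<Longrightarrow> ?g (b - h) < ?g b" by auto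
      obtain h where "0 < h" "h < min d (b - a)"
        using dense[of 0 "min d (b - a)"] \<open>d > 0\<close> ab by auto
      then show False
        using d[of h] t_min[of "b - h"] \<open>t = b\<close> by auto
    qed
    ultimately have "a < t" "t < b"
      using t by auto
    then have "deriv ?g t = 0"
      by (intro DERIV_local_min[OF J(1), of "min (t - a) (b - t)"]) (auto intro!: t_min)
    moreover have "t *\<^sub>R y \<in> Y"
      using Y(3) elim(3) \<open>a < t\<close> ab by simp
    ultimately have "t *\<^sub>R y \<in> nehari_set \<Phi> \<inter> Y"
      using Y(2) by (auto simp: nehari_set_def J(2))
    then have "\<Phi> w \<le> ?g t"
      using min by (simp add: fibering_def)
    also have "\<dots> \<le> ?g 1"
      using t_min ab by simp
    finally show ?case
      by (simp add: fibering_def)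
  qed
  then show ?thesis
    unfolding local_minimizer_def .
qed

lemma local_minimizer_imp_derivative_zero:
  assumes "C1_on UNIV \<Phi>" "local_minimizer \<Phi> w"
  shows "(\<Phi> has_derivative (\<lambda>_. 0)) (at w)"
proof -
  have D: "(\<Phi> has_derivative frechet_derivative \<Phi> (at w)) (at w)"
    using C1_on_imp_has_frechet_derivative[OF assms(1)] by simp
  obtain e where "e > 0" "\<And>y. dist y w < e \<Longrightarrow> \<Phi> w \<le> \<Phi> y"
    using assms(2) unfolding local_minimizer_def eventually_nhds_metric by blast
  then have "frechet_derivative \<Phi> (at w) = (\<lambda>_. 0)"
    by (intro has_derivative_local_min[OF D])
       (auto simp: eventually_at intro!: exI[of _ e])
  with D show ?thesis
    by simp
qed

lemma INF_minimizing_sequence: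
  fixes f :: "'a \<Rightarrow> real"
  assumes "ereal c = (INF u\<in>A. ereal (f u))"
  shows "\<exists>u :: nat \<Rightarrow> 'a. (\<forall>n. u n \<in> A) \<and> (\<lambda>n. f (u n)) \<longlonglongrightarrow> c"
proof -
  have low: "c \<le> f u" if "u \<in> A" for u
    using INF_lower[OF that, of "\<lambda>u. ereal (f u)"] unfolding assms[symmetric] by simp
  have "\<exists>u\<in>A. f u < c + inverse (real (Suc n))" for n
  proof -
    have "(INF u\<in>A. ereal (f u)) < ereal (c + inverse (real (Suc n)))"
      unfolding assms[symmetric] by simp
    then show ?thesis
      by (auto simp: INF_less_iff)
  qed
  then obtain u where u: "\<And>n. u n \<in> A" "\<And>n. f (u n) < c + inverse (real (Suc n))"
    by metis
  have "(\<lambda>n. f (u n)) \<longlonglongrightarrow> c"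
  proof (rule tendsto_sandwich[of "\<lambda>_. c"])
    show "(\<lambda>n. c + inverse (real (Suc n))) \<longlonglongrightarrow> c"
      using tendsto_add[OF tendsto_const LIMSEQ_inverse_real_of_nat, of c] by simp
  qed (use u low in \<open>auto intro!: always_eventually less_imp_le simp del: of_nat_Suc\<close>)
  with u(1) show ?thesis
    by blast
qed

theorem theorem2p3:
  fixes \<Phi> :: "'a::banach \<Rightarrow> real" and Y :: "'a set" and c :: real
  assumes reflexive: "reflexive_space TYPE('a)"
    and Y_nonempty: "Y \<noteq> {}"
    and Y_open: "open Y"
    and Y_nonzero: "0 \<notin> Y"
    and Y_cone: "\<And>t u. t > 0 \<Longrightarrow> u \<in> Y \<Longrightarrow> t *\<^sub>R u \<in> Y"
    and Phi_C1: "C1_on UNIV \<Phi>"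
    and Phi_0: "\<Phi> 0 = 0"
    and Phi_wlsc: "weakly_lsc \<Phi>"
    and J_wlsc: "weakly_lsc (nehari_functional \<Phi>)"
    and c_inf: "ereal c = (INF u\<in>nehari_set \<Phi> \<inter> Y. ereal (\<Phi> u))"
    and cond_a: "\<And>u :: nat \<Rightarrow> 'a. (\<And>n. u n \<in> nehari_set \<Phi> \<inter> Y) \<Longrightarrow> (\<lambda>n. \<Phi> (u n)) \<longlonglongrightarrow> c \<Longrightarrow>
          \<exists>r v. strict_mono (r :: nat \<Rightarrow> nat) \<and> v \<in> Y \<and> weakly_converges (u \<circ> r) v"
    and cond_b: "\<And>u. u \<in> Y \<Longrightarrow>
          C2_real_on {0<..} (fibering \<Phi> u) \<and>
          (\<exists>t\<^sub>u>0. nondegenerate_min_point (fibering \<Phi> u) t\<^sub>u \<and>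
             (\<forall>t\<in>{0<..<t\<^sub>u}. deriv (fibering \<Phi> u) t < 0) \<and>
             (\<forall>t>0. t \<noteq> t\<^sub>u \<and> deriv (fibering \<Phi> u) t = 0 \<longrightarrow>
                fibering \<Phi> u t\<^sub>u < fibering \<Phi> u t))"
    and cond_c: "\<And>(u :: nat \<Rightarrow> 'a) v. v \<in> Y \<Longrightarrow> (\<And>n. u n \<in> Y) \<Longrightarrow> weakly_converges u v \<Longrightarrow>
          (\<lambda>n. nehari_functional \<Phi> (u n)) \<longlonglongrightarrow> nehari_functional \<Phi> v \<Longrightarrow> u \<longlonglongrightarrow> v"
  shows "c < 0
    \<and> (\<exists>u \<in> nehari_set \<Phi> \<inter> Y. \<Phi> u = c)
    \<and> (C1_on Y (nehari_functional \<Phi>) \<longrightarrow> (\<exists>u. local_minimizer \<Phi> u \<and> \<Phi> u = c))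
    \<and> ((\<forall>u \<in> nehari_set \<Phi> - Y. \<Phi> u \<ge> 0) \<longrightarrow> ground_state_level \<Phi> c)"
proof -
  let ?J = "nehari_functional \<Phi>" and ?N = "nehari_set \<Phi> \<inter> Y"
  note J_ray = nehari_functional_eq_deriv_along_ray[OF Phi_C1]
  have lower: "c \<le> \<Phi> u" if "u \<in> ?N" for u
    using INF_lower[OF that, of "\<lambda>u. ereal (\<Phi> u)"] unfolding c_inf[symmetric] by simp
  have "\<forall>u\<in>Y. \<exists>t. t > 0 \<and> ?J (t *\<^sub>R u) = 0 \<and> (\<forall>s\<in>{0<..<t}. ?J (s *\<^sub>R u) < 0)
      \<and> (\<exists>d>0. \<forall>s\<in>{t<..<t+d}. 0 < ?J (s *\<^sub>R u)) \<and> \<Phi> (t *\<^sub>R u) < 0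
      \<and> (u \<in> ?N \<longrightarrow> \<Phi> (t *\<^sub>R u) \<le> \<Phi> u)"
  proof
    fix u assume "u \<in> Y"
    obtain t where t: "t > 0" "nondegenerate_min_point (fibering \<Phi> u) t"
      "\<And>s. s \<in> {0<..<t} \<Longrightarrow> deriv (fibering \<Phi> u) s < 0"
      and best: "\<And>s. s > 0 \<Longrightarrow> s \<noteq> t \<Longrightarrow> deriv (fibering \<Phi> u) s = 0
        \<Longrightarrow> fibering \<Phi> u t < fibering \<Phi> u s"
      and C2: "C2_real_on {0<..} (fibering \<Phi> u)"
      using cond_b[OF \<open>u \<in> Y\<close>] by blast
    have "\<Phi> (t *\<^sub>R u) \<le> \<Phi> u" if "u \<in> ?N"
    proof (cases "t = 1")
      case False
      have "deriv (fibering \<Phi> u) 1 = 0"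
        using that J_ray(2)[of 1 u] by (simp add: nehari_set_def)
      with best[of 1] False show ?thesis
        by (simp add: fibering_def)
    qed simp
    with ray_first_minimum[OF Phi_C1 C2 t] t(1)
    show "\<exists>t. t > 0 \<and> ?J (t *\<^sub>R u) = 0 \<and> (\<forall>s\<in>{0<..<t}. ?J (s *\<^sub>R u) < 0)
      \<and> (\<exists>d>0. \<forall>s\<in>{t<..<t+d}. 0 < ?J (s *\<^sub>R u)) \<and> \<Phi> (t *\<^sub>R u) < 0
      \<and> (u \<in> ?N \<longrightarrow> \<Phi> (t *\<^sub>R u) \<le> \<Phi> u)"
      unfolding Phi_0 by blast
  qed
  from bchoice[OF this] obtain T where "\<forall>u\<in>Y. T u > 0 \<and> ?J (T u *\<^sub>R u) = 0 \<and> (\<forall>s\<in>{0<..<T u}. ?J (s *\<^sub>R u) < 0)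
      \<and> (\<exists>d>0. \<forall>s\<in>{T u<..<T u + d}. 0 < ?J (s *\<^sub>R u)) \<and> \<Phi> (T u *\<^sub>R u) < 0
      \<and> (u \<in> ?N \<longrightarrow> \<Phi> (T u *\<^sub>R u) \<le> \<Phi> u)"
    ..
  then have T: "\<And>u. u \<in> Y \<Longrightarrow> T u > 0"
    "\<And>u. u \<in> Y \<Longrightarrow> ?J (T u *\<^sub>R u) = 0"
    "\<And>u s. u \<in> Y \<Longrightarrow> 0 < s \<Longrightarrow> s < T u \<Longrightarrow> ?J (s *\<^sub>R u) < 0"
    "\<And>u. u \<in> Y \<Longrightarrow> \<exists>d>0. \<forall>s\<in>{T u<..<T u + d}. 0 < ?J (s *\<^sub>R u)"
    "\<And>u. u \<in> Y \<Longrightarrow> \<Phi> (T u *\<^sub>R u) < 0"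
    "\<And>u. u \<in> ?N \<Longrightarrow> \<Phi> (T u *\<^sub>R u) \<le> \<Phi> u"
    by simp_all
  have T_N: "T u *\<^sub>R u \<in> ?N" if "u \<in> Y" for u
    using T(1,2)[OF that] Y_cone[of "T u" u] that Y_nonzero by (auto simp: nehari_set_def)

  have c_neg: "c < 0"
    using Y_nonempty lower T_N T(5) by (meson all_not_in_conv le_less_trans)

  \<comment> \<open>Condition (a) is applied to \<open>w\<close> and not to \<open>u\<close>: a Nehari point of \<open>Y\<close> may be a later critical
     point of its fibering map, and then \<open>J\<close> need not be \<open>\<le> 0\<close> on the segment below it.\<close>
  obtain u where u: "\<And>n. u n \<in> ?N" "(\<lambda>n. \<Phi> (u n)) \<longlonglongrightarrow> c"
    using INF_minimizing_sequence[OF c_inf] by blast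
  define w where "w n = T (u n) *\<^sub>R u n" for n :: nat
  have w_N: "w n \<in> ?N" for n
    using T_N u(1) by (simp add: w_def)
  have "(\<lambda>n. \<Phi> (w n)) \<longlonglongrightarrow> c"
  proof (rule tendsto_sandwich[of "\<lambda>_. c"])
    show "\<forall>\<^sub>F n in sequentially. c \<le> \<Phi> (w n)"
      using lower w_N by simp
    show "\<forall>\<^sub>F n in sequentially. \<Phi> (w n) \<le> \<Phi> (u n)"
      unfolding w_def using T(6) u(1) by simp
  qed (auto intro: u(2))
  moreover from cond_a[OF w_N this] obtain r v
    where r: "strict_mono (r :: nat \<Rightarrow> nat)" and v: "v \<in> Y" and weak: "weakly_converges (w \<circ> r) v"
    by blast
  ultimately have "(\<lambda>n. \<Phi> ((w \<circ> r) n)) \<longlonglongrightarrow> c"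
    using LIMSEQ_subseq_LIMSEQ[OF _ r, of "\<lambda>n. \<Phi> (w n)"] by (simp add: o_def)
  then have "liminf (\<lambda>n. ereal (\<Phi> ((w \<circ> r) n))) = ereal c"
    by (intro lim_imp_Liminf) auto
  with Phi_wlsc weak have Phi_v: "\<Phi> v \<le> c"
    unfolding weakly_lsc_def by (metis ereal_less_eq(3))
  have J_w: "?J (s *\<^sub>R w n) \<le> 0" if "0 < s" "s < 1" for s n
    using T(3)[of "u n" "s * T (u n)"] T(1)[of "u n"] u(1)[of n] that by (simp add: w_def less_imp_le)
  have J_v: "?J (s *\<^sub>R v) \<le> 0" if "0 < s" "s < 1" for s
  proof -
    have "ereal (?J (s *\<^sub>R v)) \<le> liminf (\<lambda>n. ereal (?J (s *\<^sub>R (w \<circ> r) n)))"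
      using J_wlsc weakly_converges_scaleR[OF weak, of s] unfolding weakly_lsc_def by blast
    also have "\<dots> \<le> liminf (\<lambda>n. ereal 0)"
      by (intro Liminf_mono) (simp add: J_w that)
    finally show ?thesis
      by (simp add: Liminf_const)
  qed
  have T_v: "1 \<le> T v"
  proof (rule ccontr)
    assume "\<not> 1 \<le> T v"
    obtain d where d: "d > 0" "\<And>s. s \<in> {T v<..<T v + d} \<Longrightarrow> 0 < ?J (s *\<^sub>R v)"
      using T(4)[OF v] by blast
    obtain s where "T v < s" "s < min 1 (T v + d)"
      using dense[of "T v" "min 1 (T v + d)"] \<open>d > 0\<close> \<open>\<not> 1 \<le> T v\<close> by auto
    then show False
      using d(2)[of s] J_v[of s] T(1)[OF v] by auto
  qed
  let ?z = "T v *\<^sub>R v"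
  have "fibering \<Phi> v (T v) \<le> fibering \<Phi> v 1"
  proof (rule DERIV_nonpos_imp_nonincreasing[OF T_v])
    fix s assume s: "1 \<le> s" "s \<le> T v"
    have "?J (s *\<^sub>R v) \<le> 0"
      using T(3)[OF v, of s] T(2)[OF v] s by (cases "s = T v") auto
    then have "deriv (fibering \<Phi> v) s \<le> 0"
      using s by (simp add: J_ray(2) mult_le_0_iff)
    then show "\<exists>y. (fibering \<Phi> v has_real_derivative y) (at s) \<and> y \<le> 0"
      using J_ray(1) by blast
  qed
  with Phi_v lower[OF T_N[OF v]] have Phi_z: "\<Phi> ?z = c"
    by (simp add: fibering_def)

  have loc: "local_minimizer \<Phi> ?z"
  proof -
    obtain d where d: "d > 0" "\<And>s. s \<in> {T v<..<T v + d} \<Longrightarrow> 0 < ?J (s *\<^sub>R v)"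
      using T(4)[OF v] by blast
    obtain s where s: "T v < s" "s < T v + d"
      using dense[of "T v" "T v + d"] \<open>d > 0\<close> by auto
    \<comment> \<open>In the parameter of the ray through \<open>?z\<close>, the point \<open>s v\<close> sits at \<open>s / T v\<close>.\<close>
    show ?thesis
    proof (rule local_minimizer_of_sign_change[OF Phi_C1 Y_open Y_nonzero Y_cone])
      show "\<Phi> ?z \<le> \<Phi> y" if "y \<in> ?N" for y
        using lower[OF that] Phi_z by simp
      show "?z \<in> Y"
        using T_N[OF v] by simp
      show "?J ((1/2) *\<^sub>R ?z) < 0"
        using T(1)[OF v] T(3)[OF v, of "T v / 2"] by simp
      show "0 < ?J ((s / T v) *\<^sub>R ?z)"
        using d(2)[of s] s T(1)[OF v] by simp
      show "1 < s / T v"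
        using s T(1)[OF v] by simp
    qed simp_all
  qed

  have "ground_state_level \<Phi> c" if pos: "\<forall>u \<in> nehari_set \<Phi> - Y. \<Phi> u \<ge> 0"
  proof -
    have "nontrivial_critical_point \<Phi> ?z"
      using T_N[OF v] local_minimizer_imp_derivative_zero[OF Phi_C1 loc]
      by (simp add: nontrivial_critical_point_def nehari_set_def)
    moreover have "c \<le> \<Phi> y" if "nontrivial_critical_point \<Phi> y" for y
    proof -
      have "y \<in> nehari_set \<Phi>"
        using that frechet_derivative_at[of \<Phi> "\<lambda>_. 0" y]
        by (auto simp: nontrivial_critical_point_def nehari_set_def nehari_functional_def
            dest: fun_cong)
      then show ?thesis
        using lower[of y] pos c_neg by (cases "y \<in> Y") force+
    qed
    ultimately show ?thesis
      using Phi_z by (auto simp: ground_state_level_def ground_state_def)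
  qed
  then show ?thesis
    using c_neg T_N[OF v] Phi_z loc by blast
qed

end
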